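(* Consider a constrained switching system $S(\mathbf{G}(V,E),\mathbf{M})$ with $\mathbf{M}\subset\mathbb{R}^{n\times n}$. (1) Given an irreducible node $v\in V$ and a non-trivial linear subspace $\mathcal{X}\subset\mathbb{R}^n$, the shortest cycle $c\in E^*_{v,v}$ such that $A_c\mathcal{X}\not\subseteq\mathcal{X}$ is of length $|c|\le 1+n(|V|-1)$. (2) If a pair of nodes $v,w$ is linearly connected, then the shortest path $p\in E^*_{v,w}$ with $A_p\neq 0$ is of length $|p|\le 1+n(|V|-2)$.
   Context: A finite set of matrices $\mathbf{M}=\{A_1,\dots,A_N\}\subset\mathbb{R}^{n\times n}$ is given. $\mathbf{G}(V,E)$ is an automaton: a finite, directed, labeled, strongly connected graph with node set $V$ and edge set $E$; an edge is a triple $(v,w,\sigma)$ with source $v\in V$, destination $w\in V$ and label $\sigma\in\{1,\dots,N\}$. $|V|$ is the number of nodes. A path is a sequence of consecutive edges; its length $|p|$ is its number of edges. $E^*_{v,w}$ is the set of all paths of length at least 1 from $v$ to $w$. A cycle on $v$ is an element of $E^*_{v,v}$. For a path $p$ of length $T$ with successive edge labels $\sigma(1),\dots,\sigma(T)$, put $A_p=A_{\sigma(T)}\cdots A_{\sigma(1)}$. The constrained switching system $S(\mathbf{G},\mathbf{M})$ is $x_{t+1}=A_{\sigma(t)}x_t$, where the sequence $\sigma(0),\dots,\sigma(t)$ must be the sequence of labels along some path of $\mathbf{G}$. A linear subspace $\mathcal{X}\subset\mathbb{R}^n$ is non-trivial if $0<\dim\mathcal{X}<n$. A node $v\in V$ is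 irreducible if for any non-trivial linear subspace $\mathcal{X}\subset\mathbb{R}^n$ there is a cycle $c\in E^*_{v,v}$ such that $A_c\mathcal{X}$ is not contained in $\mathcal{X}$. Given two nodes $v,w\in V$, $v$ is linearly connected to $w$ (the pair $v,w$ is linearly connected) if there exists $p\in E^*_{v,w}$ such that $A_p\neq 0$.
   Formalization: In part (2) the nodes v and w are taken to be distinct; for v = w the bound fails, e.g. n = 1, |V| = 2 and a 2-cycle with both matrices equal to (1), where the shortest nonzero cycle has length 2 > 1. *)

theory Defs
  imports "HOL-Analysis.Analysis" "Graph_Theory.Digraph_Component" "Graph_Theory.Arc_Walk"
begin

type_synonym 'v edge = "'v \<times> 'v \<times> nat"  (* (source, destination, label) *)

definition edge_label :: "'v edge \<Rightarrow> nat" where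
  "edge_label e = snd (snd e)"

definition labeled_digraph :: "'v set \<Rightarrow> 'v edge set \<Rightarrow> ('v, 'v edge) pre_digraph" where
  "labeled_digraph V E = \<lparr>verts = V, arcs = E, tail = fst, head = (\<lambda>e. fst (snd e))\<rparr>"

text \<open>The constrained switching system is given by an automaton with nodes V, edges E and labels in
  1..N together with the matrices A 1, ..., A N; the values of A at other indices play no role.
  Strong connectedness includes that V is nonempty.\<close>

locale automaton =
  fixes V :: "'v set" and E :: "'v edge set" and N :: nat
  assumes finite_digraph: "fin_digraph (labeled_digraph V E)"
    and strongly_connected: "strongly_connected (labeled_digraph V E)"
    and labels: "edge_label ` E \<subseteq> {1..N}"

definition paths :: "'v set \<Rightarrow> 'v edge set \<Rightarrow> 'v \<Rightarrow> 'v \<Rightarrow> 'v edge list set" where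
  "paths V E v w = {p. pre_digraph.awalk (labeled_digraph V E) v p w \<and> length p \<ge> 1}"

text \<open>The first edge of the path contributes the rightmost factor.\<close>

primrec path_matrix :: "(nat \<Rightarrow> real ^ 'n ^ 'n) \<Rightarrow> 'v edge list \<Rightarrow> real ^ 'n ^ 'n" where
  "path_matrix A [] = mat 1"
| "path_matrix A (e # p) = path_matrix A p ** A (edge_label e)"

definition nontrivial_subspace :: "(real ^ 'n) set \<Rightarrow> bool" where
  "nontrivial_subspace X \<longleftrightarrow> subspace X \<and> 0 < dim X \<and> dim X < CARD('n)"

definition irreducible_node ::
  "'v set \<Rightarrow> 'v edge set \<Rightarrow> (nat \<Rightarrow> real ^ 'n ^ 'n) \<Rightarrow> 'v \<Rightarrow> bool" where
  "irreducible_node V E A v \<longleftrightarrow> v \<in> V \<and>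
     (\<forall>X. nontrivial_subspace X \<longrightarrow> (\<exists>c\<in>paths V E v v. \<not> (*v) (path_matrix A c) ` X \<subseteq> X))"

definition linearly_connected ::
  "'v set \<Rightarrow> 'v edge set \<Rightarrow> (nat \<Rightarrow> real ^ 'n ^ 'n) \<Rightarrow> 'v \<Rightarrow> 'v \<Rightarrow> bool" where
  "linearly_connected V E A v w \<longleftrightarrow> v \<in> V \<and> w \<in> V \<and> (\<exists>p\<in>paths V E v w. path_matrix A p \<noteq> 0)"

end

theory Submission
  imports Defs
begin

text \<open>Both bounds come from one independence argument. Let \<open>p\<close> be a shortest path from \<open>v\<close> to \<open>w\<close> whose
  matrix sends a fixed vector \<open>x\<close> outside a subspace \<open>Y\<close>, and let \<open>x\<^sub>i\<close> be the image of \<open>x\<close> under the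
  first \<open>i\<close> edges. Suppose that \<open>p\<close> is at the same node after \<open>j\<close> and after \<open>i\<close> edges, with
  \<open>0 < j < i\<close>. Cutting out the piece of \<open>p\<close> in between gives a shorter path, so the matrix of the rest
  of \<open>p\<close> after step \<open>i\<close> sends \<open>x\<^sub>j\<close> into \<open>Y\<close>; yet it sends \<open>x\<^sub>i\<close> outside \<open>Y\<close>. Hence, at any one node,
  no \<open>x\<^sub>i\<close> lies in the span of the vectors of the earlier visits, and the number of intermediate visits
  to the node is at most the dimension \<open>n\<close>. A path with intermediate nodes in \<open>U\<close> therefore has length at
  most \<open>1 + n \<bar>U\<bar>\<close> (lemma \<open>shortest_path_length_bound\<close>).

  For the first claim \<open>Y\<close> is \<open>X\<close> itself, and \<open>x \<in> X\<close>. A shortest cycle that does not map \<open>X\<close> into \<open>X\<close> does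
  not pass through \<open>v\<close> in between, because it would split into two shorter cycles both of which preserve
  \<open>X\<close>; so \<open>U = V - {v}\<close>. For the second claim \<open>Y = {0}\<close>. A shortest path with nonzero matrix passes
  through neither \<open>v\<close> nor \<open>w\<close> in between, because a factor of a nonzero product is nonzero; so
  \<open>U = V - {v, w}\<close>.\<close>

lemma path_matrix_append:
  "path_matrix A (p @ q) = path_matrix A q ** path_matrix A p"
  by (induction p) (simp_all add: matrix_mul_assoc)

lemma path_matrix_take_drop:
  "path_matrix A p = path_matrix A (drop i p) ** path_matrix A (take i p)"
  using path_matrix_append[of A "take i p" "drop i p"] by simp

lemma paths_append:
  assumes "wf_digraph (labeled_digraph V E)"
    and "p \<in> paths V E v u" and "q \<in> paths V E u w"
  shows "p @ q \<in> paths V E v w"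
proof -
  interpret wf_digraph "labeled_digraph V E" by fact
  show ?thesis
    using assms(2,3) by (auto simp: paths_def)
qed

lemma paths_split:
  assumes "wf_digraph (labeled_digraph V E)"
    and "p \<in> paths V E v w" and "0 < i" "i < length p"
  shows "\<exists>u. u \<in> V \<and> take i p \<in> paths V E v u \<and> drop i p \<in> paths V E u w"
proof -
  interpret wf_digraph "labeled_digraph V E" by fact
  let ?u = "awlast v (take i p)"
  have "awalk v (take i p @ drop i p) w"
    using assms(2) by (simp add: paths_def)
  then have *: "awalk v (take i p) ?u" "awalk ?u (drop i p) w"
    by (simp_all only: awalk_append_iff)
  then have "?u \<in> V"
    using awalk_hd_in_verts by (fastforce simp: labeled_digraph_def)
  then show ?thesis
    using * assms(3,4) by (auto simp: paths_def)
qed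

text \<open>Adding the vectors in the order of their indices keeps the family independent. The index set is
  arbitrary because the visits of a path to one node are at irregular steps.\<close>

lemma card_le_dim_if_not_in_span_of_predecessors:
  fixes f :: "nat \<Rightarrow> 'a::euclidean_space"
  assumes "finite I" and "\<And>i. i \<in> I \<Longrightarrow> f i \<notin> span (f ` {j \<in> I. j < i})"
  shows "card I \<le> DIM('a)"
proof -
  have "independent (f ` I) \<and> inj_on f I"
    using assms
  proof (induction rule: finite_linorder_max_induct)
    case empty
    then show ?case by (simp add: independent_empty)
  next
    case (insert b I)
    have "f i \<notin> span (f ` {j \<in> I. j < i})" if "i \<in> I" for i
    proof -
      have "{j \<in> insert b I. j < i} = {j \<in> I. j < i}"
        using insert.hyps(2) that by (auto dest: order.strict_trans)
      then show ?thesis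
        using insert.prems[of i] that by simp
    qed
    with insert.IH have IH: "independent (f ` I)" "inj_on f I" by auto
    have "{j \<in> insert b I. j < b} = I"
      using insert.hyps(2) by auto
    then have b: "f b \<notin> span (f ` I)"
      using insert.prems[of b] by simp
    then have "f b \<notin> f ` I"
      using span_base by blast
    then show ?case
      using IH b by (auto simp: independent_insert)
  qed
  then show ?thesis
    using independent_bound[of "f ` I"] by (simp add: card_image)
qed

text \<open>A path of length \<open>T\<close> has \<open>T - 1\<close> intermediate positions, and the independence argument lets each
  node of \<open>U\<close> occupy at most \<open>n\<close> of them. The set \<open>U\<close> has to contain only the nodes at these positions,
  which is what later allows the end nodes to be left out.\<close>

lemma shortest_path_length_bound:
  fixes A :: "nat \<Rightarrow> real ^ 'n ^ 'n"
  assumes wf: "wf_digraph (labeled_digraph V E)"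
    and p: "p \<in> paths V E v w"
    and Y: "subspace Y"
    and escapes: "path_matrix A p *v x \<notin> Y"
    and shorter: "\<And>q. q \<in> paths V E v w \<Longrightarrow> length q < length p \<Longrightarrow> path_matrix A q *v x \<in> Y"
    and "finite U"
    and interior: "\<And>i u. 0 < i \<Longrightarrow> i < length p \<Longrightarrow> u \<in> V \<Longrightarrow>
      take i p \<in> paths V E v u \<Longrightarrow> drop i p \<in> paths V E u w \<Longrightarrow> u \<in> U"
  shows "length p \<le> 1 + CARD('n) * card U"
proof -
  obtain node where node: "\<And>i. i \<in> {1..<length p} \<Longrightarrow>
      node i \<in> V \<and> take i p \<in> paths V E v (node i) \<and> drop i p \<in> paths V E (node i) w"
    using paths_split[OF wf p] by (metis atLeastLessThan_iff less_eq_Suc_le One_nat_def)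
  define visits where "visits u = {i \<in> {1..<length p}. node i = u}" for u
  have visits_le: "card (visits u) \<le> CARD('n)" for u
  proof -
    let ?x = "\<lambda>i. path_matrix A (take i p) *v x"
    have "?x i \<notin> span (?x ` {j \<in> visits u. j < i})" if i: "i \<in> visits u" for i
    proof
      let ?rest = "path_matrix A (drop i p)"
      let ?Z = "(\<lambda>y. ?rest *v y) -` Y"
      have "?x j \<in> ?Z" if j: "j \<in> visits u" "j < i" for j
      proof -
        let ?q = "take j p @ drop i p"
        have "take j p \<in> paths V E v u" "drop i p \<in> paths V E u w"
          using node[of j] node[of i] i j by (simp_all add: visits_def)
        then have "?q \<in> paths V E v w"
          using paths_append[OF wf] by blast
        moreover have "length ?q < length p"
          using i j by (auto simp: visits_def)
        ultimately have "path_matrix A ?q *v x \<in> Y"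
          by (rule shorter)
        then show ?thesis
          by (simp add: path_matrix_append matrix_vector_mul_assoc)
      qed
      then have "?x ` {j \<in> visits u. j < i} \<subseteq> ?Z" by auto
      moreover have "subspace ?Z"
        using Y by (intro linear_subspace_vimage) auto
      moreover assume "?x i \<in> span (?x ` {j \<in> visits u. j < i})"
      ultimately have "?x i \<in> ?Z"
        using span_minimal by blast
      then have "path_matrix A p *v x \<in> Y"
        by (simp add: path_matrix_take_drop[of A p i] matrix_vector_mul_assoc)
      with escapes show False by contradiction
    qed
    then have "card (visits u) \<le> DIM(real ^ 'n)"
      by (intro card_le_dim_if_not_in_span_of_predecessors[where f = ?x])
        (simp_all add: visits_def)
    then show ?thesis by simp
  qed
  have "node i \<in> U" if "i \<in> {1..<length p}" for i
    using interior[of i "node i"] node[OF that] that by simp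
  then have "{1..<length p} \<subseteq> (\<Union>u\<in>U. visits u)"
    by (auto simp: visits_def)
  then have "card {1..<length p} \<le> card (\<Union>u\<in>U. visits u)"
    using \<open>finite U\<close> by (intro card_mono) (auto simp: visits_def)
  also have "\<dots> \<le> (\<Sum>u\<in>U. card (visits u))"
    using \<open>finite U\<close> by (rule card_UN_le)
  also have "\<dots> \<le> card U * CARD('n)"
    using sum_bounded_above[of U "\<lambda>u. card (visits u)" "CARD('n)"] visits_le by simp
  finally show ?thesis by (simp add: mult.commute)
qed

lemma shortest_escaping_cycle_bound:
  fixes A :: "nat \<Rightarrow> real ^ 'n ^ 'n"
  assumes wf: "wf_digraph (labeled_digraph V E)" and "finite V" and "subspace X"
    and min: "is_arg_min length
      (\<lambda>c. c \<in> paths V E v v \<and> \<not> (*v) (path_matrix A c) ` X \<subseteq> X) c"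
  shows "length c \<le> 1 + CARD('n) * card (V - {v})"
proof -
  have c: "c \<in> paths V E v v" "\<not> (*v) (path_matrix A c) ` X \<subseteq> X"
    using min by (auto simp: is_arg_min_def)
  have preserves: "(*v) (path_matrix A q) ` X \<subseteq> X"
    if "q \<in> paths V E v v" "length q < length c" for q
    using min that by (auto simp: is_arg_min_def)
  from c obtain x where x: "x \<in> X" "path_matrix A c *v x \<notin> X" by blast
  show ?thesis
  proof (rule shortest_path_length_bound[OF wf c(1) \<open>subspace X\<close> x(2)])
    show "path_matrix A q *v x \<in> X" if "q \<in> paths V E v v" "length q < length c" for q
      using preserves[OF that] x(1) by blast
    show "finite (V - {v})" using \<open>finite V\<close> by simp
    fix i u
    assume i: "0 < i" "i < length c" and "u \<in> V"
      and u: "take i c \<in> paths V E v u" "drop i c \<in> paths V E u v"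
    have len: "length (take i c) < length c" "length (drop i c) < length c"
      using i by simp_all
    have "u \<noteq> v"
    proof
      assume "u = v"
      then have "path_matrix A (drop i c) *v (path_matrix A (take i c) *v x) \<in> X"
        using preserves[OF _ len(1)] preserves[OF _ len(2)] u x(1) by blast
      then show False
        using x(2) by (simp add: path_matrix_take_drop[of A c i] matrix_vector_mul_assoc)
    qed
    with \<open>u \<in> V\<close> show "u \<in> V - {v}" by simp
  qed
qed

lemma shortest_nonzero_path_bound:
  fixes A :: "nat \<Rightarrow> real ^ 'n ^ 'n"
  assumes wf: "wf_digraph (labeled_digraph V E)" and "finite V"
    and min: "is_arg_min length (\<lambda>p. p \<in> paths V E v w \<and> path_matrix A p \<noteq> 0) p"
  shows "length p \<le> 1 + CARD('n) * card (V - {v, w})"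
proof -
  have p: "p \<in> paths V E v w" "path_matrix A p \<noteq> 0"
    using min by (auto simp: is_arg_min_def)
  have vanishes: "path_matrix A q = 0"
    if "q \<in> paths V E v w" "length q < length p" for q
    using min that by (auto simp: is_arg_min_def)
  from p(2) obtain x where x: "path_matrix A p *v x \<notin> {0}"
    by (metis matrix_eq matrix_vector_mult_0 singletonI singletonD)
  show ?thesis
  proof (rule shortest_path_length_bound[OF wf p(1) subspace_single_0 x])
    show "path_matrix A q *v x \<in> {0}" if "q \<in> paths V E v w" "length q < length p" for q
      using vanishes[OF that] by simp
    show "finite (V - {v, w})" using \<open>finite V\<close> by simp
    fix i u
    assume i: "0 < i" "i < length p" and "u \<in> V"
      and u: "take i p \<in> paths V E v u" "drop i p \<in> paths V E u w"
    have len: "length (take i p) < length p" "length (drop i p) < length p"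
      using i by simp_all
    have factors: "path_matrix A (drop i p) \<noteq> 0" "path_matrix A (take i p) \<noteq> 0"
      using p(2) path_matrix_take_drop[of A p i] by auto
    have "u \<noteq> v" using vanishes[OF _ len(2)] factors(1) u(2) by blast
    moreover have "u \<noteq> w" using vanishes[OF _ len(1)] factors(2) u(1) by blast
    ultimately show "u \<in> V - {v, w}" using \<open>u \<in> V\<close> by simp
  qed
qed

theorem theorem2p7:
  fixes V :: "'v set" and E :: "'v edge set"
    and N :: nat and A :: "nat \<Rightarrow> real ^ 'n ^ 'n"
  assumes "automaton V E N"
  shows "(\<forall>v X. irreducible_node V E A v \<and> nontrivial_subspace X \<longrightarrow>
            (\<exists>c. is_arg_min length (\<lambda>c. c \<in> paths V E v v \<and> \<not> (*v) (path_matrix A c) ` X \<subseteq> X) c) \<and>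
            (\<forall>c. is_arg_min length (\<lambda>c. c \<in> paths V E v v \<and> \<not> (*v) (path_matrix A c) ` X \<subseteq> X) c \<longrightarrow>
               int (length c) \<le> 1 + int CARD('n) * (int (card V) - 1)))
       \<and> (\<forall>v w. v \<noteq> w \<and> linearly_connected V E A v w \<longrightarrow>
            (\<exists>p. is_arg_min length (\<lambda>p. p \<in> paths V E v w \<and> path_matrix A p \<noteq> 0) p) \<and>
            (\<forall>p. is_arg_min length (\<lambda>p. p \<in> paths V E v w \<and> path_matrix A p \<noteq> 0) p \<longrightarrow>
               int (length p) \<le> 1 + int CARD('n) * (int (card V) - 2)))"
proof -
  interpret fin_digraph "labeled_digraph V E"
    using assms by (rule automaton.finite_digraph)
  have wf: "wf_digraph (labeled_digraph V E)" ..
  have fin: "finite V"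
    using finite_verts by (simp add: labeled_digraph_def)
  show ?thesis
  proof (intro conjI allI impI; elim conjE)
    fix v X
    let ?P = "\<lambda>c. c \<in> paths V E v v \<and> \<not> (*v) (path_matrix A c) ` X \<subseteq> X"
    assume irr: "irreducible_node V E A v" and X: "nontrivial_subspace X"
    then obtain c where "?P c"
      unfolding irreducible_node_def by blast
    then show "\<exists>c. is_arg_min length ?P c"
      using is_arg_min_arg_min_nat[of ?P] by blast
    fix c
    assume "is_arg_min length ?P c"
    with wf fin have "length c \<le> 1 + CARD('n) * card (V - {v})"
      using X by (intro shortest_escaping_cycle_bound) (simp_all add: nontrivial_subspace_def)
    then have "int (length c) \<le> 1 + int CARD('n) * int (card (V - {v}))"
      by (simp flip: of_nat_mult of_nat_Suc)
    moreover have "int (card (V - {v})) = int (card V) - 1"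
      using irr fin card_Suc_Diff1[of V v] by (simp add: irreducible_node_def)
    ultimately show "int (length c) \<le> 1 + int CARD('n) * (int (card V) - 1)"
      by simp
  next
    fix v w
    let ?P = "\<lambda>p. p \<in> paths V E v w \<and> path_matrix A p \<noteq> 0"
    assume "v \<noteq> w" and conn: "linearly_connected V E A v w"
    then obtain p where "?P p"
      unfolding linearly_connected_def by blast
    then show "\<exists>p. is_arg_min length ?P p"
      using is_arg_min_arg_min_nat[of ?P] by blast
    fix p
    assume "is_arg_min length ?P p"
    with wf fin have "length p \<le> 1 + CARD('n) * card (V - {v, w})"
      by (rule shortest_nonzero_path_bound)
    then have "int (length p) \<le> 1 + int CARD('n) * int (card (V - {v, w}))"
      by (simp flip: of_nat_mult of_nat_Suc)
    moreover have "int (card (V - {v, w})) = int (card V) - 2"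
    proof -
      have vw: "{v, w} \<subseteq> V" using conn by (simp add: linearly_connected_def)
      have "card V = card (V - {v, w}) + card {v, w}"
        using card_Diff_subset[of "{v, w}" V] card_mono[OF fin vw] vw by simp
      then show ?thesis using \<open>v \<noteq> w\<close> by simp
    qed
    ultimately show "int (length p) \<le> 1 + int CARD('n) * (int (card V) - 2)"
      by simp
  qed
qed

end
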